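(* Let $M$ be the complement of the figure-eight knot in $S^3$, with $\pi_1(M)=\langle\alpha,\beta\mid R(\alpha,\beta)\rangle$, $R(\alpha,\beta)=\beta^{-1}\alpha^{-1}\beta\alpha\beta^{-1}\alpha\beta\alpha^{-1}\beta^{-1}\alpha$. Let $X(M)\subset\mathbb{C}^3$ be its $SL_2(\mathbb{C})$-character variety, with affine coordinates $(x,y,z)=(\chi(\alpha),\chi(\beta),\chi(\alpha\beta))$. Then the affine variety $X(M)\subset\mathbb{C}^3$ is defined by the equations $$x=y,\qquad (x^2-z-2)\bigl(z^2-(1+x^2)z+2x^2-1\bigr)=0 .$$ In particular, $X(M)$ can be identified with the affine plane curve $\{(x,z)\in\mathbb{C}^2\mid(x^2-z-2)(z^2-(1+x^2)z+2x^2-1)=0\}$. It has two irreducible components.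
   Context: $R(M)=\mathrm{Hom}(\pi_1(M),SL_2(\mathbb{C}))$. The character of $\rho\in R(M)$ is $\chi(g)=\mathrm{tr}\,\rho(g)$, and it is determined by its values on $\alpha,\beta,\alpha\beta$. $X(M)$ is the image of the map $R(M)\to\mathbb{C}^3$, $\rho\mapsto(\chi(\alpha),\chi(\beta),\chi(\alpha\beta))$. *)

theory Defs
  imports "HOL-Analysis.Analysis" "HOL-Algebra.Group"
begin

section \<open>The fundamental group\<close>

definition loops_at :: "'a::topological_space set \<Rightarrow> 'a \<Rightarrow> (real \<Rightarrow> 'a) set" where
  "loops_at M p =
     {\<gamma>. path \<gamma> \<and> path_image \<gamma> \<subseteq> M \<and> pathstart \<gamma> = p \<and> pathfinish \<gamma> = p}"

definition loop_class :: "'a::topological_space set \<Rightarrow> (real \<Rightarrow> 'a) \<Rightarrow> (real \<Rightarrow> 'a) set" where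
  "loop_class M \<gamma> = {\<delta>. homotopic_paths M \<gamma> \<delta>}"

definition fundamental_group ::
    "'a::real_normed_vector set \<Rightarrow> 'a \<Rightarrow> (real \<Rightarrow> 'a) set monoid" where
  "fundamental_group M p =
     \<lparr> carrier = loop_class M ` loops_at M p,
       mult = (\<lambda>A B. \<Union>\<gamma>\<in>A. \<Union>\<delta>\<in>B. loop_class M (\<gamma> +++ \<delta>)),
       one = loop_class M (linepath p p) \<rparr>"

lemma loop_class_eq_iff:
  assumes "\<gamma> \<in> loops_at M p"
  shows "loop_class M \<gamma> = loop_class M \<delta> \<longleftrightarrow> homotopic_paths M \<gamma> \<delta>"
proof
  assume eq: "loop_class M \<gamma> = loop_class M \<delta>"
  have "\<gamma> \<in> loop_class M \<gamma>" using assms by (simp add: loop_class_def loops_at_def)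
  with eq show "homotopic_paths M \<gamma> \<delta>"
    by (simp add: loop_class_def homotopic_paths_sym_eq)
next
  assume h: "homotopic_paths M \<gamma> \<delta>"
  then have "homotopic_paths M \<gamma> \<epsilon> \<longleftrightarrow> homotopic_paths M \<delta> \<epsilon>" for \<epsilon>
    using homotopic_paths_sym homotopic_paths_trans by blast
  then show "loop_class M \<gamma> = loop_class M \<delta>" by (simp add: loop_class_def)
qed

lemma fundamental_group_mult:
  assumes "\<gamma> \<in> loops_at M p" "\<delta> \<in> loops_at M p"
  shows "loop_class M \<gamma> \<otimes>\<^bsub>fundamental_group M p\<^esub> loop_class M \<delta> = loop_class M (\<gamma> +++ \<delta>)"
proof -
  have l: "\<gamma> +++ \<delta> \<in> loops_at M p"
    using assms by (auto simp: loops_at_def path_image_join)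
  have eq: "loop_class M (\<gamma>' +++ \<delta>') = loop_class M (\<gamma> +++ \<delta>)"
    if "\<gamma>' \<in> loop_class M \<gamma>" "\<delta>' \<in> loop_class M \<delta>" for \<gamma>' \<delta>'
  proof -
    have "homotopic_paths M \<gamma> \<gamma>'" "homotopic_paths M \<delta> \<delta>'"
      using that by (simp_all add: loop_class_def)
    moreover have "pathfinish \<gamma> = pathstart \<delta>" using assms by (simp add: loops_at_def)
    ultimately have "homotopic_paths M (\<gamma> +++ \<delta>) (\<gamma>' +++ \<delta>')"
      by (rule homotopic_paths_join)
    then show ?thesis using loop_class_eq_iff[OF l] by blast
  qed
  have mem: "\<gamma> \<in> loop_class M \<gamma>" "\<delta> \<in> loop_class M \<delta>"
    using assms by (simp_all add: loop_class_def loops_at_def)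
  have "(\<Union>\<gamma>'\<in>loop_class M \<gamma>. \<Union>\<delta>'\<in>loop_class M \<delta>. loop_class M (\<gamma>' +++ \<delta>'))
      = (\<Union>\<gamma>'\<in>loop_class M \<gamma>. \<Union>\<delta>'\<in>loop_class M \<delta>. loop_class M (\<gamma> +++ \<delta>))"
    by (intro SUP_cong refl eq)
  also have "\<dots> = loop_class M (\<gamma> +++ \<delta>)"
    using mem unfolding UN_constant by (metis empty_iff)
  finally show ?thesis by (simp add: fundamental_group_def)
qed

lemma group_fundamental_group:
  assumes p: "p \<in> M"
  shows "group (fundamental_group M p)"
proof -
  let ?G = "fundamental_group M p"
  have car: "carrier ?G = loop_class M ` loops_at M p"
    and one: "\<one>\<^bsub>?G\<^esub> = loop_class M (linepath p p)"
    by (simp_all add: fundamental_group_def)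
  have join: "\<gamma> +++ \<delta> \<in> loops_at M p" if "\<gamma> \<in> loops_at M p" "\<delta> \<in> loops_at M p" for \<gamma> \<delta>
    using that by (auto simp: loops_at_def path_image_join)
  have const: "linepath p p \<in> loops_at M p"
    using p by (auto simp: loops_at_def)
  have rev: "reversepath \<gamma> \<in> loops_at M p" if "\<gamma> \<in> loops_at M p" for \<gamma>
    using that by (auto simp: loops_at_def)
  note m = fundamental_group_mult
  show ?thesis
  proof (rule groupI)
    fix x y assume "x \<in> carrier ?G" "y \<in> carrier ?G"
    then show "x \<otimes>\<^bsub>?G\<^esub> y \<in> carrier ?G"
      by (auto simp: car m intro!: imageI join)
  next
    show "\<one>\<^bsub>?G\<^esub> \<in> carrier ?G" using const by (simp add: car one)
  next
    fix x y z assume "x \<in> carrier ?G" "y \<in> carrier ?G" "z \<in> carrier ?G"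
    then obtain a b c where abc: "a \<in> loops_at M p" "b \<in> loops_at M p" "c \<in> loops_at M p"
      and xyz: "x = loop_class M a" "y = loop_class M b" "z = loop_class M c"
      by (auto simp: car)
    have "homotopic_paths M (a +++ (b +++ c)) ((a +++ b) +++ c)"
      using abc by (intro homotopic_paths_assoc) (auto simp: loops_at_def)
    then have "loop_class M ((a +++ b) +++ c) = loop_class M (a +++ (b +++ c))"
      using loop_class_eq_iff join abc by metis
    then show "x \<otimes>\<^bsub>?G\<^esub> y \<otimes>\<^bsub>?G\<^esub> z = x \<otimes>\<^bsub>?G\<^esub> (y \<otimes>\<^bsub>?G\<^esub> z)"
      using abc by (simp add: xyz m join)
  next
    fix x assume "x \<in> carrier ?G"
    then obtain a where a: "a \<in> loops_at M p" and x: "x = loop_class M a"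
      by (auto simp: car)
    have "homotopic_paths M (linepath p p +++ a) a"
      using a homotopic_paths_lid[of a M] by (simp add: loops_at_def)
    then show "\<one>\<^bsub>?G\<^esub> \<otimes>\<^bsub>?G\<^esub> x = x"
      using a const by (simp add: one x m loop_class_eq_iff[OF join[OF const a]])
    have "homotopic_paths M (reversepath a +++ a) (linepath p p)"
      using a homotopic_paths_linv[of a M] by (simp add: loops_at_def)
    then have "loop_class M (reversepath a) \<otimes>\<^bsub>?G\<^esub> x = \<one>\<^bsub>?G\<^esub>"
      using a rev by (simp add: one x m loop_class_eq_iff[OF join[OF rev[OF a] a]])
    then show "\<exists>y\<in>carrier ?G. y \<otimes>\<^bsub>?G\<^esub> x = \<one>\<^bsub>?G\<^esub>"
      using rev[OF a] car by blast
  qed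
qed


section \<open>The figure-eight knot\<close>

definition inverse_stereographic :: "real^3 \<Rightarrow> real^4" where
  "inverse_stereographic v =
     (1 / ((norm v)\<^sup>2 + 1)) *\<^sub>R vector [2 * v$1, 2 * v$2, 2 * v$3, (norm v)\<^sup>2 - 1]"

text \<open>
  The curve below winds three times around the third axis.  Its projection along that axis
  has exactly four crossings, at parameters \<open>t\<close> and \<open>t + 2\<pi>/3\<close> with \<open>4t \<equiv> -4\<pi>/3\<close> modulo \<open>2\<pi>\<close>;
  it is the closure of the alternating 3-braid \<open>\<sigma>\<^sub>1 \<sigma>\<^sub>2\<^sup>-\<^sup>1 \<sigma>\<^sub>1 \<sigma>\<^sub>2\<^sup>-\<^sup>1\<close>, i.e. the figure-eight knot.
\<close>

definition standard_figure_eight :: "(real^4) set" where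
  "standard_figure_eight = range (\<lambda>t. inverse_stereographic
     (vector [(2 + cos (2 * t)) * cos (3 * t), (2 + cos (2 * t)) * sin (3 * t), sin (4 * t)]))"

text \<open>
  Knots are taken up to self-homeomorphisms of the 3-sphere.  Orientations are immaterial,
  since the figure-eight knot is amphichiral.
\<close>

definition figure_eight_knot :: "(real^4) set \<Rightarrow> bool" where
  "figure_eight_knot K \<longleftrightarrow>
     (\<exists>f g. homeomorphism (sphere 0 1) (sphere 0 1) f g \<and> K = f ` standard_figure_eight)"


section \<open>Group presentations\<close>

text \<open>
  A word is a list of letters; the letter \<open>(s, True)\<close> stands for the generator \<open>s\<close> and
  \<open>(s, False)\<close> for its inverse.  Words modulo the congruence generated by free
  cancellation and by the relators are the elements of the presented group.
\<close>

type_synonym 's word = "('s \<times> bool) list"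

inductive word_congruent :: "'s word set \<Rightarrow> 's word \<Rightarrow> 's word \<Rightarrow> bool" for R where
  refl: "word_congruent R u u"
| sym: "word_congruent R u v \<Longrightarrow> word_congruent R v u"
| trans: "word_congruent R u v \<Longrightarrow> word_congruent R v w \<Longrightarrow> word_congruent R u w"
| cancel: "word_congruent R (u @ [(s, e), (s, \<not> e)] @ v) (u @ v)"
| relator: "r \<in> R \<Longrightarrow> word_congruent R (u @ r @ v) (u @ v)"

primrec word_value :: "('g, 'b) monoid_scheme \<Rightarrow> ('s \<Rightarrow> 'g) \<Rightarrow> 's word \<Rightarrow> 'g" where
  "word_value G \<phi> [] = \<one>\<^bsub>G\<^esub>"
| "word_value G \<phi> (l # w) =
     (if snd l then \<phi> (fst l) else inv\<^bsub>G\<^esub> (\<phi> (fst l))) \<otimes>\<^bsub>G\<^esub> word_value G \<phi> w"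

definition group_presentation :: "('g, 'b) monoid_scheme \<Rightarrow> ('s \<Rightarrow> 'g) \<Rightarrow> 's word set \<Rightarrow> bool" where
  "group_presentation G \<phi> R \<longleftrightarrow>
     group G \<and> range \<phi> \<subseteq> carrier G \<and>
     range (word_value G \<phi>) = carrier G \<and>
     (\<forall>u v. word_value G \<phi> u = word_value G \<phi> v \<longleftrightarrow> word_congruent R u v)"

datatype two_generators = Gen_a | Gen_b

definition figure_eight_relator :: "two_generators word" where
  "figure_eight_relator =
     (let a = (Gen_a, True); a' = (Gen_a, False); b = (Gen_b, True); b' = (Gen_b, False)
      in [b', a', b, a, b', a, b, a', b', a])"


section \<open>Characters of representations into the special linear group\<close>

definition SL2C :: "(complex^2^2) monoid" where
  "SL2C = \<lparr> carrier = {A. det A = 1}, mult = (**), one = mat 1 \<rparr>"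

lemma group_SL2C: "group SL2C"
proof (rule groupI)
  fix A assume "A \<in> carrier SL2C"
  then have A: "det A = 1" by (simp add: SL2C_def)
  then obtain B where B: "B ** A = mat 1" "A ** B = mat 1"
    using invertible_det_nz[of A] unfolding invertible_def by auto
  then have "det B = 1" using A det_mul[of B A] by simp
  then show "\<exists>B\<in>carrier SL2C. B \<otimes>\<^bsub>SL2C\<^esub> A = \<one>\<^bsub>SL2C\<^esub>"
    using B by (auto simp: SL2C_def)
qed (simp_all add: SL2C_def det_mul matrix_mul_assoc)

definition rep_character :: "('g \<Rightarrow> complex^2^2) \<Rightarrow> 'g \<Rightarrow> complex" where
  "rep_character \<rho> g = trace (\<rho> g)"

definition character_variety :: "('g, 'b) monoid_scheme \<Rightarrow> 'g \<Rightarrow> 'g \<Rightarrow> (complex^3) set" where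
  "character_variety G \<alpha> \<beta> =
     (\<lambda>\<rho>. vector [rep_character \<rho> \<alpha>, rep_character \<rho> \<beta>, rep_character \<rho> (\<alpha> \<otimes>\<^bsub>G\<^esub> \<beta>)])
       ` hom G SL2C"


section \<open>Affine algebraic sets\<close>

text \<open>
  Since the complex field is infinite, multivariate polynomials may be identified with the
  functions they induce on affine space.
\<close>

inductive polynomial_fun :: "(complex^'n \<Rightarrow> complex) \<Rightarrow> bool" where
  const: "polynomial_fun (\<lambda>v. c)"
| coord: "polynomial_fun (\<lambda>v. v $ i)"
| add: "polynomial_fun p \<Longrightarrow> polynomial_fun q \<Longrightarrow> polynomial_fun (\<lambda>v. p v + q v)"
| mult: "polynomial_fun p \<Longrightarrow> polynomial_fun q \<Longrightarrow> polynomial_fun (\<lambda>v. p v * q v)"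

definition polynomial_map :: "(complex^'n \<Rightarrow> complex^'m) \<Rightarrow> bool" where
  "polynomial_map f \<longleftrightarrow> (\<forall>i. polynomial_fun (\<lambda>v. f v $ i))"

definition algebraic_set :: "(complex^'n) set \<Rightarrow> bool" where
  "algebraic_set V \<longleftrightarrow> (\<exists>P. (\<forall>p\<in>P. polynomial_fun p) \<and> V = {v. \<forall>p\<in>P. p v = 0})"

definition irreducible_algebraic_set :: "(complex^'n) set \<Rightarrow> bool" where
  "irreducible_algebraic_set V \<longleftrightarrow>
     algebraic_set V \<and> V \<noteq> {} \<and>
     (\<forall>A B. algebraic_set A \<longrightarrow> algebraic_set B \<longrightarrow> V = A \<union> B \<longrightarrow> V = A \<or> V = B)"

definition irreducible_components :: "(complex^'n) set \<Rightarrow> (complex^'n) set set" where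
  "irreducible_components V =
     {W. irreducible_algebraic_set W \<and> W \<subseteq> V \<and>
         (\<forall>W'. irreducible_algebraic_set W' \<longrightarrow> W \<subseteq> W' \<longrightarrow> W' \<subseteq> V \<longrightarrow> W' = W)}"

definition algebraic_set_isomorphism ::
    "(complex^'n) set \<Rightarrow> (complex^'m) set \<Rightarrow> (complex^'n \<Rightarrow> complex^'m) \<Rightarrow> bool" where
  "algebraic_set_isomorphism V W f \<longleftrightarrow>
     algebraic_set V \<and> algebraic_set W \<and> polynomial_map f \<and> f ` V \<subseteq> W \<and>
     (\<exists>g. polynomial_map g \<and> g ` W \<subseteq> V \<and> (\<forall>v\<in>V. g (f v) = v) \<and> (\<forall>w\<in>W. f (g w) = w))"

end

(*
  With W = A' B A B' (primes denoting inverses), the relation says W A = B W; in particular A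
  and B have the same trace x.  For A, B in SL_2 with common trace x and tr AB = z, one has
    W A - B W = (z^2 - (1 + x^2) z + 2 x^2 - 1) (A - B),
  so the relation holds iff A = B, whence z = x^2 - 2, or the quadratic vanishes.  As every
  triple (x, x, z) consists of the traces of some A, B, this gives the equations of X.

  The component z = x^2 - 2 is a graph.  On the other one, (z - 2) x^2 = z^2 - z - 1, so a
  polynomial is, up to powers of z - 2, of the form P(z) + x Q(z); its norm
  (z - 2) P^2 - (z^2 - z - 1) Q^2 has two terms of different parity of order at z = 2, hence
  vanishes only for P = Q = 0.  Multiplicativity of the norm yields irreducibility.
*)

theory Submission
  imports Defs "HOL-Computational_Algebra.Polynomial"
begin

section \<open>Homomorphisms out of a presented group\<close>

lemma word_value_closed:
  assumes "group G" "range \<phi> \<subseteq> carrier G"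
  shows "word_value G \<phi> w \<in> carrier G"
proof -
  interpret group G by fact
  show ?thesis using assms(2) by (induction w) auto
qed

lemma word_value_append:
  assumes "group G" "range \<phi> \<subseteq> carrier G"
  shows "word_value G \<phi> (u @ v) = word_value G \<phi> u \<otimes>\<^bsub>G\<^esub> word_value G \<phi> v"
proof -
  interpret group G by fact
  have [simp]: "\<phi> s \<in> carrier G" for s using assms(2) by auto
  show ?thesis
    by (induction u) (simp_all add: word_value_closed[OF assms] m_assoc)
qed

lemma word_value_hom:
  assumes "group G" "group H" "\<rho> \<in> hom G H" "range \<phi> \<subseteq> carrier G"
  shows "\<rho> (word_value G \<phi> w) = word_value H (\<rho> \<circ> \<phi>) w"
proof -
  interpret group_hom G H \<rho>
    using assms by (simp add: group_hom_def group_hom_axioms_def)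
  have [simp]: "\<phi> s \<in> carrier G" for s using assms(4) by auto
  show ?thesis
    by (induction w) (simp_all add: word_value_closed[OF assms(1,4)])
qed

text \<open>Each generating rule of the congruence preserves values in \<open>H\<close>. This makes
  evaluation in \<open>H\<close> well defined on the elements of a presented group.\<close>

lemma word_congruent_value_eq:
  assumes "group H" "range \<psi> \<subseteq> carrier H" "\<And>r. r \<in> R \<Longrightarrow> word_value H \<psi> r = \<one>\<^bsub>H\<^esub>"
    and "word_congruent R u v"
  shows "word_value H \<psi> u = word_value H \<psi> v"
proof -
  interpret group H by fact
  have [simp]: "\<psi> s \<in> carrier H" for s using assms(2) by auto
  note [simp] = word_value_append[OF assms(1,2)] word_value_closed[OF assms(1,2)]
  from assms(4) show ?thesis
  proof induction
    case (cancel u s e v)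
    have "word_value H \<psi> [(s, e), (s, \<not> e)] = \<one>\<^bsub>H\<^esub>" by simp
    then show ?case using word_value_append[OF assms(1,2)]
      by (metis l_one word_value_closed[OF assms(1,2)])
  next
    case (relator r u v)
    then show ?case by (simp add: assms(3))
  qed simp_all
qed

lemma group_presentation_relator:
  assumes "group_presentation G \<phi> R" "r \<in> R"
  shows "word_value G \<phi> r = \<one>\<^bsub>G\<^esub>"
proof -
  have "word_congruent R r []"
    using word_congruent.relator[OF assms(2), of "[]" "[]"] by simp
  then have "word_value G \<phi> r = word_value G \<phi> []"
    using assms(1) by (simp add: group_presentation_def del: word_value.simps)
  then show ?thesis by simp
qed

text \<open>Von Dyck's theorem, the universal property of a presentation. An element goes to the
  value under \<open>\<psi>\<close> of any word spelling it; two spellings are congruent, so their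
  values agree.\<close>

lemma group_presentation_hom_exists:
  assumes pres: "group_presentation G \<phi> R"
    and H: "group H" "range \<psi> \<subseteq> carrier H" "\<And>r. r \<in> R \<Longrightarrow> word_value H \<psi> r = \<one>\<^bsub>H\<^esub>"
  obtains \<rho> where "\<rho> \<in> hom G H" "\<And>s. \<rho> (\<phi> s) = \<psi> s"
proof
  have G: "group G" "range \<phi> \<subseteq> carrier G"
    and surj: "range (word_value G \<phi>) = carrier G"
    and cong: "word_value G \<phi> u = word_value G \<phi> v \<longleftrightarrow> word_congruent R u v" for u v
    using pres by (simp_all add: group_presentation_def)
  interpret G: group G by fact
  interpret H: group H by fact
  define \<rho> where "\<rho> g = word_value H \<psi> (SOME u. word_value G \<phi> u = g)" for g
  have \<rho>: "\<rho> (word_value G \<phi> u) = word_value H \<psi> u" for u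
  proof -
    have "word_value G \<phi> (SOME v. word_value G \<phi> v = word_value G \<phi> u) = word_value G \<phi> u"
      by (rule someI[of "\<lambda>v. word_value G \<phi> v = word_value G \<phi> u" u]) simp
    then show ?thesis
      unfolding \<rho>_def using cong word_congruent_value_eq[OF H] by blast
  qed
  show "\<rho> \<in> hom G H"
  proof (rule homI)
    fix g assume "g \<in> carrier G"
    then obtain u where "g = word_value G \<phi> u" using surj by blast
    then show "\<rho> g \<in> carrier H" using \<rho> word_value_closed[OF H(1,2)] by simp
  next
    fix g h assume "g \<in> carrier G" "h \<in> carrier G"
    then obtain u v where uv: "g = word_value G \<phi> u" "h = word_value G \<phi> v" using surj by blast
    show "\<rho> (g \<otimes>\<^bsub>G\<^esub> h) = \<rho> g \<otimes>\<^bsub>H\<^esub> \<rho> h"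
      unfolding uv word_value_append[OF G, symmetric] \<rho>
      by (rule word_value_append[OF H(1,2)])
  qed
  fix s
  have "\<phi> s \<in> carrier G" "\<psi> s \<in> carrier H" using G(2) H(2) by auto
  then show "\<rho> (\<phi> s) = \<psi> s"
    using \<rho>[of "[(s, True)]"] by simp
qed


section \<open>The relator in the special linear group\<close>

text \<open>Cayley-Hamilton: A^2 - tr(A) A + 1 = 0 when det A = 1. Inverses thus become tr(A) - A,
  which makes every word in \<open>A\<close> and \<open>B\<close> polynomial in the matrix
  entries.\<close>

lemma SL2_adjugate:
  fixes A :: "complex^2^2"
  assumes "det A = 1"
  shows "A ** (mat (trace A) - A) = mat 1" "(mat (trace A) - A) ** A = mat 1"
  using assms
  by (simp_all add: vec_eq_iff forall_2 matrix_matrix_mult_def sum_2 mat_def trace_def det_2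
      algebra_simps)

lemma det_mat_trace_diff:
  fixes A :: "complex^2^2"
  shows "det (mat (trace A) - A) = det A"
  by (simp add: mat_def trace_def det_2 sum_2 algebra_simps)

lemma SL2C_simps [simp]:
  "A \<in> carrier SL2C \<longleftrightarrow> det A = 1" "A \<otimes>\<^bsub>SL2C\<^esub> B = A ** B" "\<one>\<^bsub>SL2C\<^esub> = mat 1"
  by (simp_all add: SL2C_def)

lemma inv_SL2C:
  assumes "det A = 1"
  shows "inv\<^bsub>SL2C\<^esub> A = mat (trace A) - A"
  using assms
  by (intro group.inv_equality group_SL2C) (simp_all add: SL2_adjugate det_mat_trace_diff)

text \<open>The trace of the Cayley-Hamilton identity. For a pair of equal matrices it yields z =
  x^2 - 2, the equation of the first component.\<close>

lemma trace_square_SL2: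
  fixes A :: "complex^2^2"
  assumes "det A = 1"
  shows "trace (A ** A) = (trace A)\<^sup>2 - 2"
  using assms
  by (simp add: trace_def matrix_matrix_mult_def sum_2 det_2 power2_eq_square algebra_simps)

text \<open>A polynomial identity in the matrix entries. The common trace eliminates
  \<open>d\<close> and \<open>h\<close>, the determinants rewrite \<open>b * c\<close> and
  \<open>f * g\<close>, and both sides then have the same normal form.\<close>

lemma figure_eight_relation_identity:
  fixes A B :: "complex^2^2"
  assumes "det A = 1" "det B = 1" "trace A = x" "trace B = x" "trace (A ** B) = z"
    and "A' = mat x - A" "B' = mat x - B"
  shows "A' ** B ** A ** B' ** A - B ** A' ** B ** A ** B' =
    mat (z\<^sup>2 - (1 + x\<^sup>2) * z + 2 * x\<^sup>2 - 1) ** (A - B)"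
proof -
  define a b c d where ab: "a = A$1$1" "b = A$1$2" "c = A$2$1" "d = A$2$2"
  define e f g h where eh: "e = B$1$1" "f = B$1$2" "g = B$2$1" "h = B$2$2"
  have d: "d = x - a" and h: "h = x - e"
    using assms(3,4) by (auto simp: ab eh trace_def sum_2 eq_diff_eq add.commute)
  have bc: "b * c = a * (x - a) - 1" and fg: "f * g = e * (x - e) - 1"
    using assms(1,2) unfolding det_2 d[symmetric] h[symmetric] by (simp_all add: ab eh algebra_simps)
  have z: "z = a*e+b*g+c*f+d*h"
    unfolding assms(5)[symmetric] by (simp add: ab eh trace_def sum_2 matrix_matrix_mult_def)
  \<comment> \<open>The same two rules with a trailing factor \<open>t\<close>, so that rewriting
    also reaches these products inside longer monomials.\<close>
  have bc': "b * (c * t) = (a * (x - a) - 1) * t" and fg': "f * (g * t) = (e * (x - e) - 1) * t" for t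
    using bc fg by (metis mult.assoc)+
  show ?thesis
    unfolding assms(6,7)
    by (simp add: vec_eq_iff forall_2 matrix_matrix_mult_def sum_2 mat_def flip: ab eh)
       (simp add: z d h algebra_simps power2_eq_square bc bc' fg fg')
qed

lemma mat_mult_eq_0_iff:
  fixes M :: "complex^2^2"
  shows "mat c ** M = 0 \<longleftrightarrow> c = 0 \<or> M = 0"
  by (auto simp: vec_eq_iff forall_2 matrix_matrix_mult_def sum_2 mat_def)

text \<open>The relation makes \<open>B\<close> a conjugate of \<open>A\<close>, which forces equal
  traces. Once the traces agree the preceding identity applies, and a scalar matrix annihilates
  \<open>A - B\<close> only if the scalar or \<open>A - B\<close> is zero.\<close>

lemma figure_eight_relator_SL2C_iff:
  assumes A: "det A = 1" and B: "det B = 1"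
  defines "x \<equiv> trace A" and "z \<equiv> trace (A ** B)"
  shows "word_value SL2C (case_two_generators A B) figure_eight_relator = mat 1 \<longleftrightarrow>
    trace B = x \<and> (A = B \<or> z\<^sup>2 - (1 + x\<^sup>2) * z + 2 * x\<^sup>2 - 1 = 0)"
    (is "?rel \<longleftrightarrow> _ \<and> (_ \<or> ?c = 0)")
proof -
  define A' B' where A': "A' = mat (trace A) - A" and B': "B' = mat (trace B) - B"
  have inv: "A ** A' = mat 1" "A' ** A = mat 1" "B ** B' = mat 1" "B' ** B = mat 1"
    using SL2_adjugate A B by (auto simp: A' B')
  have inv': "A ** (A' ** X) = X" "A' ** (A ** X) = X" "B ** (B' ** X) = X" "B' ** (B ** X) = X"
    for X :: "complex^2^2"
    by (simp_all add: matrix_mul_assoc inv)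
  \<comment> \<open>The relator reads \<open>B' ** W ** A ** W'\<close>: its last four letters spell
    the inverse of letters two to five.\<close>
  define W W' where W: "W = A' ** B ** A ** B'" and W': "W' = B ** A' ** B' ** A"
  have WW: "W ** W' = mat 1" "W' ** W = mat 1"
    by (simp_all add: W W' inv inv' flip: matrix_mul_assoc)
  have "?rel \<longleftrightarrow> B' ** W ** A ** W' = mat 1"
    by (simp add: figure_eight_relator_def Let_def inv_SL2C A B W W' flip: matrix_mul_assoc A' B')
  also have "\<dots> \<longleftrightarrow> W ** A = B ** W"
  proof
    assume *: "B' ** W ** A ** W' = mat 1"
    have "W ** A = B ** (B' ** W ** A ** W') ** W"
      by (simp add: inv' WW flip: matrix_mul_assoc)
    then show "W ** A = B ** W" by (simp add: *)
  next
    assume "W ** A = B ** W"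
    then have "B' ** W ** A ** W' = B' ** (B ** W) ** W'" by (simp flip: matrix_mul_assoc)
    then show "B' ** W ** A ** W' = mat 1"
      by (simp add: inv' WW flip: matrix_mul_assoc)
  qed
  finally have rel: "?rel \<longleftrightarrow> W ** A = B ** W" .
  have tr: "trace B = x" if "W ** A = B ** W"
  proof -
    have "trace B = trace ((B ** W) ** W')" by (simp add: WW flip: matrix_mul_assoc)
    also have "\<dots> = trace (W' ** (W ** A))" unfolding that[symmetric] by (rule trace_mul_sym)
    also have "\<dots> = x" by (simp add: WW matrix_mul_assoc x_def)
    finally show ?thesis .
  qed
  have "W ** A = B ** W \<longleftrightarrow> A = B \<or> ?c = 0" if "trace B = x"
  proof -
    have "W ** A - B ** W = mat ?c ** (A - B)"
      unfolding W matrix_mul_assoc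
      by (rule figure_eight_relation_identity) (use A B A' B' that x_def z_def in auto)
    then show ?thesis
      unfolding eq_iff_diff_eq_0[of "W ** A"] by (simp only: mat_mult_eq_0_iff) auto
  qed
  with rel tr show ?thesis by blast
qed

text \<open>\<open>A\<close> is the companion matrix of s^2 - x s + 1, and \<open>B\<close> is
  chosen so that \<open>A ** B\<close> is upper triangular with diagonal entries 1/t and t.\<close>

lemma SL2_traces_exist:
  obtains A B :: "complex^2^2"
  where "det A = 1" "det B = 1" "trace A = x" "trace B = x" "trace (A ** B) = z"
proof -
  \<comment> \<open>A root of t^2 - z t + 1; hence \<open>t\<close> is nonzero and t + 1/t =
    z.\<close>
  define t where "t = (z + csqrt (z\<^sup>2 - 4)) / 2"
  have "t * (z - t) = (z\<^sup>2 - (csqrt (z\<^sup>2 - 4))\<^sup>2) / 4"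
    by (simp add: t_def algebra_simps power2_eq_square add_divide_distrib diff_divide_distrib)
  then have t: "t * (z - t) = 1" by simp
  then have "t \<noteq> 0" by auto
  moreover from this have "z = 1 / t + t" using t by (simp add: field_simps)
  ultimately show ?thesis
    by (intro that[of "vector [vector [x, -1], vector [1, 0]]" "vector [vector [0, t], vector [-1 / t, x]]"])
       (simp_all add: det_2 trace_def sum_2 matrix_matrix_mult_def)
qed

text \<open>One inclusion evaluates the relator under a representation. The other finds matrices
  with the prescribed traces that satisfy the relator, and extends them to a representation by von
  Dyck's theorem.\<close>

lemma character_variety_figure_eight:
  assumes pres: "group_presentation G (case_two_generators \<alpha> \<beta>) {figure_eight_relator}"
  shows "character_variety G \<alpha> \<beta> = {v. v$1 = v$2 \<and>
    ((v$1)\<^sup>2 - v$3 - 2) * ((v$3)\<^sup>2 - (1 + (v$1)\<^sup>2) * v$3 + 2 * (v$1)\<^sup>2 - 1) = 0}"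
    (is "_ = ?E")
proof (intro equalityI subsetI)
  have G: "group G" "range (case_two_generators \<alpha> \<beta>) \<subseteq> carrier G"
    using pres by (simp_all add: group_presentation_def)
  then have ab: "\<alpha> \<in> carrier G" "\<beta> \<in> carrier G"
    by (auto simp: image_subset_iff split: two_generators.split_asm dest: spec[of _ Gen_a] spec[of _ Gen_b])
  {
    fix v assume "v \<in> character_variety G \<alpha> \<beta>"
    then obtain \<rho> where \<rho>: "\<rho> \<in> hom G SL2C"
      and v: "v = vector [trace (\<rho> \<alpha>), trace (\<rho> \<beta>), trace (\<rho> (\<alpha> \<otimes>\<^bsub>G\<^esub> \<beta>))]"
      by (auto simp: character_variety_def rep_character_def)
    define A B where "A = \<rho> \<alpha>" "B = \<rho> \<beta>"
    have AB: "\<rho> (\<alpha> \<otimes>\<^bsub>G\<^esub> \<beta>) = A ** B" "det A = 1" "det B = 1"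
      using hom_mult[OF \<rho> ab] hom_in_carrier[OF \<rho>] ab by (simp_all add: A_B_def)
    have "\<rho> \<circ> case_two_generators \<alpha> \<beta> = case_two_generators A B"
      by (auto simp: A_B_def fun_eq_iff split: two_generators.split)
    then have "word_value SL2C (case_two_generators A B) figure_eight_relator = mat 1"
      using word_value_hom[OF G(1) group_SL2C \<rho> G(2), of figure_eight_relator]
        group_presentation_relator[OF pres, of figure_eight_relator]
        hom_one[OF \<rho> G(1) group_SL2C] by simp
    then show "v \<in> ?E"
      using figure_eight_relator_SL2C_iff[of A B] trace_square_SL2[of A] AB
      by (auto simp: v simp flip: A_B_def)
  }
  fix v assume v: "v \<in> ?E"
  obtain A B :: "complex^2^2" where AB: "det A = 1" "det B = 1"
    "trace A = v$1" "trace B = v$2" "trace (A ** B) = v$3"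
    "word_value SL2C (case_two_generators A B) figure_eight_relator = mat 1"
  proof -
    obtain A B :: "complex^2^2" where AB: "det A = 1" "det B = 1"
      "trace A = v$1" "trace B = v$1" "trace (A ** B) = v$3"
      using SL2_traces_exist .
    show thesis
    proof (cases "(v$1)\<^sup>2 - v$3 - 2 = 0")
      \<comment> \<open>The pair just found need not satisfy the relation here. It is replaced by
        \<open>A\<close>, \<open>A\<close>, whose product has trace x^2 - 2 = z.\<close>
      case True
      then have "v$3 = (v$1)\<^sup>2 - 2" by (simp add: algebra_simps)
      then show ?thesis
        using AB v figure_eight_relator_SL2C_iff[of A A] trace_square_SL2[of A]
        by (intro that[of A A]) auto
    next
      case False
      then show ?thesis
        using AB v figure_eight_relator_SL2C_iff[of A B] by (intro that[of A B]) auto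
    qed
  qed
  obtain \<rho> where \<rho>: "\<rho> \<in> hom G SL2C"
    and "\<And>s. \<rho> (case_two_generators \<alpha> \<beta> s) = case_two_generators A B s"
  proof (rule group_presentation_hom_exists[OF pres group_SL2C, of "case_two_generators A B"])
    show "range (case_two_generators A B) \<subseteq> carrier SL2C"
      using AB by (auto split: two_generators.split)
  qed (use AB in auto)
  from this(2)[of Gen_a] this(2)[of Gen_b] have \<rho>AB: "\<rho> \<alpha> = A" "\<rho> \<beta> = B" by simp_all
  have "v = vector [rep_character \<rho> \<alpha>, rep_character \<rho> \<beta>, rep_character \<rho> (\<alpha> \<otimes>\<^bsub>G\<^esub> \<beta>)]"
    unfolding vec_eq_iff forall_3
    by (simp add: rep_character_def hom_mult[OF \<rho> ab] \<rho>AB AB(3-5))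
  with \<rho> show "v \<in> character_variety G \<alpha> \<beta>"
    unfolding character_variety_def by blast
qed


section \<open>Irreducible algebraic sets\<close>

lemma polynomial_fun_diff:
  assumes "polynomial_fun p" "polynomial_fun q"
  shows "polynomial_fun (\<lambda>v. p v - q v)"
  using polynomial_fun.add[OF assms(1) polynomial_fun.mult[OF polynomial_fun.const[of "-1"] assms(2)]]
  by simp

lemma polynomial_fun_power:
  assumes "polynomial_fun p"
  shows "polynomial_fun (\<lambda>v. p v ^ n)"
proof (induction n)
  case 0
  show ?case using polynomial_fun.const[of 1] by simp
next
  case (Suc n)
  show ?case using polynomial_fun.mult[OF assms Suc] by simp
qed

lemmas polynomial_fun_intros = polynomial_fun.intros polynomial_fun_diff polynomial_fun_power

lemma polynomial_fun_compose:
  assumes "polynomial_fun p" "polynomial_map f"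
  shows "polynomial_fun (\<lambda>v. p (f v))"
  using assms(1)
proof induction
  case (coord i)
  then show ?case using assms(2) by (simp add: polynomial_map_def)
qed (rule polynomial_fun.const polynomial_fun.add polynomial_fun.mult; assumption)+

lemma algebraic_set_zeros:
  assumes "polynomial_fun p"
  shows "algebraic_set {v. p v = 0}"
  unfolding algebraic_set_def using assms by (intro exI[of _ "{p}"]) auto

lemma algebraic_setE:
  assumes "algebraic_set V"
  obtains P where "\<And>p. p \<in> P \<Longrightarrow> polynomial_fun p" "\<And>v. v \<in> V \<longleftrightarrow> (\<forall>p\<in>P. p v = 0)"
proof -
  obtain P where P: "\<forall>p\<in>P. polynomial_fun p" and V: "V = {v. \<forall>p\<in>P. p v = 0}"
    using assms unfolding algebraic_set_def by (elim exE conjE)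
  show ?thesis by (rule that[of P]) (simp_all add: P V)
qed

lemma irreducible_algebraic_set_UnD:
  assumes "irreducible_algebraic_set V" "algebraic_set A" "algebraic_set B" "V = A \<union> B"
  shows "V = A \<or> V = B"
  using assms by (simp add: irreducible_algebraic_set_def)

lemma algebraic_set_Int:
  assumes "algebraic_set A" "algebraic_set B"
  shows "algebraic_set (A \<inter> B)"
proof -
  obtain P where P: "\<And>p. p \<in> P \<Longrightarrow> polynomial_fun p" "\<And>v. v \<in> A \<longleftrightarrow> (\<forall>p\<in>P. p v = 0)"
    by (rule algebraic_setE[OF assms(1)]) blast
  obtain Q where Q: "\<And>q. q \<in> Q \<Longrightarrow> polynomial_fun q" "\<And>v. v \<in> B \<longleftrightarrow> (\<forall>q\<in>Q. q v = 0)"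
    by (rule algebraic_setE[OF assms(2)]) blast
  have "A \<inter> B = {v. \<forall>p\<in>P \<union> Q. p v = 0}"
    by (auto simp: P(2) Q(2))
  then show ?thesis
    unfolding algebraic_set_def using P(1) Q(1) by (intro exI[of _ "P \<union> Q"]) auto
qed

text \<open>Primality of the vanishing ideal suffices. If \<open>A\<close> and \<open>B\<close> were
  both proper, an equation of \<open>A\<close> failing at some point of \<open>V\<close> and an
  equation of \<open>B\<close> failing at another would have a product vanishing on
  \<open>V\<close>.\<close>

lemma irreducible_algebraic_setI:
  assumes "algebraic_set V" "V \<noteq> {}"
    and prime: "\<And>p q. polynomial_fun p \<Longrightarrow> polynomial_fun q \<Longrightarrow> (\<And>v. v \<in> V \<Longrightarrow> p v * q v = 0) \<Longrightarrow>
      (\<forall>v\<in>V. p v = 0) \<or> (\<forall>v\<in>V. q v = 0)"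
  shows "irreducible_algebraic_set V"
  unfolding irreducible_algebraic_set_def
proof (intro conjI assms(1,2) allI impI)
  fix A B assume AB: "algebraic_set A" "algebraic_set B" "V = A \<union> B"
  obtain P where P: "\<And>p. p \<in> P \<Longrightarrow> polynomial_fun p" "\<And>v. v \<in> A \<longleftrightarrow> (\<forall>p\<in>P. p v = 0)"
    by (rule algebraic_setE[OF AB(1)]) blast
  obtain Q where Q: "\<And>q. q \<in> Q \<Longrightarrow> polynomial_fun q" "\<And>v. v \<in> B \<longleftrightarrow> (\<forall>q\<in>Q. q v = 0)"
    by (rule algebraic_setE[OF AB(2)]) blast
  show "V = A \<or> V = B"
  proof (rule ccontr)
    assume "\<not> (V = A \<or> V = B)"
    then obtain v w where vw: "v \<in> V" "v \<notin> A" "w \<in> V" "w \<notin> B"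
      using AB(3) by auto
    obtain p where p: "p \<in> P" "p v \<noteq> 0" using vw(2) by (auto simp: P(2))
    obtain q where q: "q \<in> Q" "q w \<noteq> 0" using vw(4) by (auto simp: Q(2))
    have "p u * q u = 0" if "u \<in> V" for u
      using that p(1) q(1) by (auto simp: AB(3) P(2) Q(2))
    then have "(\<forall>v\<in>V. p v = 0) \<or> (\<forall>v\<in>V. q v = 0)"
      by (rule prime[OF P(1)[OF p(1)] Q(1)[OF q(1)]])
    then show False using vw p q by auto
  qed
qed

text \<open>Conversely, the zero sets of \<open>p\<close> and \<open>q\<close> cut \<open>V\<close>
  into two algebraic pieces, one of which must be all of \<open>V\<close>.\<close>

lemma irreducible_algebraic_setD:
  assumes V: "irreducible_algebraic_set V"
    and pq: "polynomial_fun p" "polynomial_fun q" "\<And>v. v \<in> V \<Longrightarrow> p v * q v = 0"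
  shows "(\<forall>v\<in>V. p v = 0) \<or> (\<forall>v\<in>V. q v = 0)"
proof -
  have V': "algebraic_set V" using V by (simp add: irreducible_algebraic_set_def)
  have "V = V \<inter> {v. p v = 0} \<or> V = V \<inter> {v. q v = 0}"
  proof (rule irreducible_algebraic_set_UnD[OF V])
    show "algebraic_set (V \<inter> {v. p v = 0})" "algebraic_set (V \<inter> {v. q v = 0})"
      using pq by (auto intro!: algebraic_set_Int algebraic_set_zeros V')
    show "V = V \<inter> {v. p v = 0} \<union> V \<inter> {v. q v = 0}"
      using pq(3) by auto
  qed
  then show ?thesis by (auto simp: set_eq_iff)
qed

text \<open>Primality is pulled back along \<open>f\<close>. That the image is algebraic has to be
  assumed, since polynomial images of algebraic sets need not be algebraic.\<close>

lemma irreducible_algebraic_set_image: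
  assumes V: "irreducible_algebraic_set V" and f: "polynomial_map f"
    and "algebraic_set (f ` V)"
  shows "irreducible_algebraic_set (f ` V)"
proof (rule irreducible_algebraic_setI[OF assms(3)])
  show "f ` V \<noteq> {}" using V by (simp add: irreducible_algebraic_set_def)
  fix p q assume pq: "polynomial_fun p" "polynomial_fun q" "\<And>v. v \<in> f ` V \<Longrightarrow> p v * q v = 0"
  have "(\<forall>v\<in>V. p (f v) = 0) \<or> (\<forall>v\<in>V. q (f v) = 0)"
    by (rule irreducible_algebraic_setD[OF V polynomial_fun_compose[OF pq(1) f]
          polynomial_fun_compose[OF pq(2) f]]) (simp add: pq(3))
  then show "(\<forall>v\<in>f ` V. p v = 0) \<or> (\<forall>v\<in>f ` V. q v = 0)"
    by simp
qed

lemma irreducible_subset_Un: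
  assumes W: "irreducible_algebraic_set W" and AB: "algebraic_set A" "algebraic_set B" "W \<subseteq> A \<union> B"
  shows "W \<subseteq> A \<or> W \<subseteq> B"
proof -
  have W': "algebraic_set W" using W by (simp add: irreducible_algebraic_set_def)
  have "W = W \<inter> A \<or> W = W \<inter> B"
    by (rule irreducible_algebraic_set_UnD[OF W algebraic_set_Int[OF W' AB(1)]
          algebraic_set_Int[OF W' AB(2)]]) (use AB(3) in auto)
  then show ?thesis by (auto simp: set_eq_iff)
qed

text \<open>Every irreducible subset of the union lies in \<open>A\<close> or in \<open>B\<close>,
  so only these two can be maximal; since neither contains the other, both are.\<close>

lemma irreducible_components_Un:
  assumes A: "irreducible_algebraic_set A" and B: "irreducible_algebraic_set B"
    and nsub: "\<not> A \<subseteq> B" "\<not> B \<subseteq> A"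
  shows "irreducible_components (A \<union> B) = {A, B}"
proof -
  have "algebraic_set A" "algebraic_set B"
    using A B by (simp_all add: irreducible_algebraic_set_def)
  then have *: "W \<subseteq> A \<or> W \<subseteq> B" if "irreducible_algebraic_set W" "W \<subseteq> A \<union> B" for W
    using that irreducible_subset_Un[of W A B] by simp
  show ?thesis
  proof (intro equalityI subsetI)
    fix W assume "W \<in> irreducible_components (A \<union> B)"
    then have W: "irreducible_algebraic_set W" "W \<subseteq> A \<union> B"
      and max: "\<And>W'. irreducible_algebraic_set W' \<Longrightarrow> W \<subseteq> W' \<Longrightarrow> W' \<subseteq> A \<union> B \<Longrightarrow> W' = W"
      by (simp_all add: irreducible_components_def)
    show "W \<in> {A, B}"
      using *[OF W] max[OF A] max[OF B] by auto
  next
    have "A \<in> irreducible_components (A \<union> B)"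
      unfolding irreducible_components_def using A * nsub by fastforce
    moreover have "B \<in> irreducible_components (A \<union> B)"
      unfolding irreducible_components_def using B * nsub by fastforce
    ultimately show "W \<in> irreducible_components (A \<union> B)" if "W \<in> {A, B}" for W
      using that by auto
  qed
qed

lemma card_irreducible_components_Un:
  assumes "irreducible_algebraic_set A" "irreducible_algebraic_set B"
    and "\<not> A \<subseteq> B" "\<not> B \<subseteq> A"
  shows "card (irreducible_components (A \<union> B)) = 2"
proof -
  have "A \<noteq> B" using assms(3) by blast
  then show ?thesis by (simp add: irreducible_components_Un[OF assms])
qed


section \<open>The two components\<close>

lemma polynomial_fun_parametrized:
  assumes "polynomial_fun p"
  shows "\<exists>Q. \<forall>t. p (\<chi> i. poly (P i) t) = poly Q t"
  using assms
proof induction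
  case (const c)
  show ?case by (rule exI[of _ "[:c:]"]) simp
next
  case (coord i)
  show ?case by (rule exI[of _ "P i"]) simp
next
  case (add p q)
  then show ?case by (metis poly_add)
next
  case (mult p q)
  then show ?case by (metis poly_mult)
qed

text \<open>Along the parametrization \<open>p\<close> and \<open>q\<close> become polynomials in
  one variable. Their product vanishes at every complex number, so it is zero, and complex
  polynomials form an integral domain.\<close>

lemma irreducible_polynomial_curve:
  assumes "algebraic_set V" "V = range (\<lambda>t. \<chi> i. poly (P i) t)"
  shows "irreducible_algebraic_set V"
proof (rule irreducible_algebraic_setI[OF assms(1)])
  show "V \<noteq> {}" using assms(2) by blast
  fix p q assume pq: "polynomial_fun p" "polynomial_fun q" "\<And>v. v \<in> V \<Longrightarrow> p v * q v = 0"
  obtain p' q' where *: "\<And>t. p (\<chi> i. poly (P i) t) = poly p' t" "\<And>t. q (\<chi> i. poly (P i) t) = poly q' t"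
    using polynomial_fun_parametrized pq(1,2) by metis
  have "poly (p' * q') t = 0" for t
    using pq(3)[of "\<chi> i. poly (P i) t"] * assms(2) by simp
  then have "p' * q' = 0" using poly_all_0_iff_0 by blast
  then show "(\<forall>v\<in>V. p v = 0) \<or> (\<forall>v\<in>V. q v = 0)"
    using assms(2) * by auto
qed

text \<open>These are the characters of the reducible representations; the curve is a graph over x,
  which serves as the parameter.\<close>

lemma irreducible_reducible_characters:
  "irreducible_algebraic_set {v :: complex^2. (v$1)\<^sup>2 - v$2 - 2 = 0}"
proof (rule irreducible_polynomial_curve)
  show "algebraic_set {v :: complex^2. (v$1)\<^sup>2 - v$2 - 2 = 0}"
    by (intro algebraic_set_zeros polynomial_fun_intros)
  show "{v :: complex^2. (v$1)\<^sup>2 - v$2 - 2 = 0} =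
      range (\<lambda>t. \<chi> i. poly (if i = 1 then [:0, 1:] else [:-2, 0, 1:]) t)"
    by (auto simp: image_iff vec_eq_iff forall_2 power2_eq_square algebra_simps)
qed

section \<open>The second component, treated by a norm in a quadratic extension\<close>

text \<open>The equation of the curve trades each x^2 for (z^2 - z - 1) / (z - 2); \<open>N\<close>
  counts the factors z - 2 that clear the denominators.\<close>

lemma polynomial_fun_linear_in_x:
  fixes p :: "complex^2 \<Rightarrow> complex"
  assumes "polynomial_fun p"
  shows "\<exists>N P Q. \<forall>v. (v$2 - 2) * (v$1)\<^sup>2 = (v$2)\<^sup>2 - v$2 - 1 \<longrightarrow>
    (v$2 - 2) ^ N * p v = poly P (v$2) + v$1 * poly Q (v$2)"
  using assms
proof induction
  case (const c)
  show ?case by (rule exI[of _ 0], rule exI[of _ "[:c:]"], rule exI[of _ 0]) simp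
next
  case (coord i)
  consider "i = 1" | "i = 2" using exhaust_2 by blast
  then show ?case
  proof cases
    case 1
    then show ?thesis by (intro exI[of _ 0] exI[of _ 1]) simp
  next
    case 2
    then show ?thesis
      by (intro exI[of _ "0::nat"]) (rule exI[of _ "[:0, 1:]"], rule exI[of _ 0], simp)
  qed
next
  case (add p q)
  then obtain N P Q N' P' Q' where
    "\<forall>v. (v$2 - 2) * (v$1)\<^sup>2 = (v$2)\<^sup>2 - v$2 - 1 \<longrightarrow>
      (v$2 - 2) ^ N * p v = poly P (v$2) + v$1 * poly Q (v$2)"
    "\<forall>v. (v$2 - 2) * (v$1)\<^sup>2 = (v$2)\<^sup>2 - v$2 - 1 \<longrightarrow>
      (v$2 - 2) ^ N' * q v = poly P' (v$2) + v$1 * poly Q' (v$2)"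
    by blast
  note * = this[rule_format]
  show ?case
  proof (rule exI[of _ "N + N'"], rule exI[of _ "[:-2, 1:] ^ N' * P + [:-2, 1:] ^ N * P'"],
      rule exI[of _ "[:-2, 1:] ^ N' * Q + [:-2, 1:] ^ N * Q'"], intro allI impI)
    fix v :: "complex^2" assume v: "(v$2 - 2) * (v$1)\<^sup>2 = (v$2)\<^sup>2 - v$2 - 1"
    have "(v$2 - 2) ^ (N + N') * (p v + q v) =
      (v$2 - 2) ^ N' * ((v$2 - 2) ^ N * p v) + (v$2 - 2) ^ N * ((v$2 - 2) ^ N' * q v)"
      by (simp add: power_add algebra_simps)
    then show "(v$2 - 2) ^ (N + N') * (p v + q v) =
      poly ([:-2, 1:] ^ N' * P + [:-2, 1:] ^ N * P') (v$2) +
      v$1 * poly ([:-2, 1:] ^ N' * Q + [:-2, 1:] ^ N * Q') (v$2)"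
      unfolding *[OF v] by (simp add: algebra_simps)
  qed
next
  case (mult p q)
  then obtain N P Q N' P' Q' where
    "\<forall>v. (v$2 - 2) * (v$1)\<^sup>2 = (v$2)\<^sup>2 - v$2 - 1 \<longrightarrow>
      (v$2 - 2) ^ N * p v = poly P (v$2) + v$1 * poly Q (v$2)"
    "\<forall>v. (v$2 - 2) * (v$1)\<^sup>2 = (v$2)\<^sup>2 - v$2 - 1 \<longrightarrow>
      (v$2 - 2) ^ N' * q v = poly P' (v$2) + v$1 * poly Q' (v$2)"
    by blast
  note * = this[rule_format]
  show ?case
  \<comment> \<open>The product of two forms linear in x contains x^2. The additional factor z - 2,
    the \<open>+ 1\<close> in the exponent, turns it into z^2 - z - 1, which is
    \<open>[:-1, -1, 1:]\<close>.\<close>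
  proof (rule exI[of _ "N + N' + 1"], rule exI[of _ "[:-2, 1:] * P * P' + [:-1, -1, 1:] * Q * Q'"],
      rule exI[of _ "[:-2, 1:] * (P * Q' + Q * P')"], intro allI impI)
    fix v :: "complex^2" assume v: "(v$2 - 2) * (v$1)\<^sup>2 = (v$2)\<^sup>2 - v$2 - 1"
    have "(v$2 - 2) ^ (N + N' + 1) * (p v * q v) =
      (v$2 - 2) * ((v$2 - 2) ^ N * p v) * ((v$2 - 2) ^ N' * q v)"
      by (simp add: power_add algebra_simps)
    also have "\<dots> = (v$2 - 2) * poly P (v$2) * poly P' (v$2) +
       ((v$2 - 2) * (v$1)\<^sup>2) * poly Q (v$2) * poly Q' (v$2) +
       v$1 * ((v$2 - 2) * (poly P (v$2) * poly Q' (v$2) + poly Q (v$2) * poly P' (v$2)))"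
      unfolding *[OF v] by (simp add: algebra_simps power2_eq_square)
    finally show "(v$2 - 2) ^ (N + N' + 1) * (p v * q v) =
      poly ([:-2, 1:] * P * P' + [:-1, -1, 1:] * Q * Q') (v$2) +
      v$1 * poly ([:-2, 1:] * (P * Q' + Q * P')) (v$2)"
      unfolding v by (simp add: algebra_simps power2_eq_square)
  qed
qed

text \<open>As z^2 - z - 1 is 1 at z = 2, the two terms have orders 1 + 2 ord P and 2 ord Q there.
  In other words, (z^2 - z - 1) / (z - 2) is not the square of a rational function.\<close>

lemma norm_form_eq_0:
  fixes P Q :: "complex poly"
  assumes "[:-2, 1:] * P\<^sup>2 - [:-1, -1, 1:] * Q\<^sup>2 = 0"
  shows "P = 0 \<and> Q = 0"
proof (rule ccontr)
  assume "\<not> ?thesis"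
  with assms have nz: "P \<noteq> 0" "Q \<noteq> 0" by (auto simp del: mult_pCons_left)
  have "order 2 [:-2, 1 :: complex:] = 1" "order 2 [:-1, -1, 1 :: complex:] = 0"
    using order_power_n_n[of "2 :: complex" 1] by (simp_all add: order_0I)
  moreover have "order 2 ([:-2, 1:] * (P * P)) = order 2 ([:-1, -1, 1:] * (Q * Q))"
    using assms by (simp add: power2_eq_square)
  ultimately have "1 + 2 * order 2 P = 2 * order 2 Q"
    using nz by (simp add: order_mult del: mult_pCons_left)
  then show False by presburger
qed

text \<open>This curve contains the characters of all irreducible representations. If
  \<open>p * q\<close> vanishes on it, the product of the two norms is zero, so one norm is zero and
  the corresponding factor vanishes on the curve.\<close>

lemma irreducible_irreducible_characters:
  "irreducible_algebraic_set {v :: complex^2. (v$2)\<^sup>2 - (1 + (v$1)\<^sup>2) * v$2 + 2 * (v$1)\<^sup>2 - 1 = 0}"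
    (is "irreducible_algebraic_set ?V")
proof (rule irreducible_algebraic_setI)
  show "algebraic_set ?V"
    by (intro algebraic_set_zeros polynomial_fun_intros)
  have "vector [1, 1] \<in> ?V" by simp
  then show "?V \<noteq> {}" by blast
  have V: "v \<in> ?V \<longleftrightarrow> (v$2 - 2) * (v$1)\<^sup>2 = (v$2)\<^sup>2 - v$2 - 1" for v :: "complex^2"
    by (auto simp: algebra_simps)
  fix p q :: "complex^2 \<Rightarrow> complex"
  assume p: "polynomial_fun p" and q: "polynomial_fun q" and pq: "\<And>v. v \<in> ?V \<Longrightarrow> p v * q v = 0"
  obtain N P Q where p': "(v$2 - 2) ^ N * p v = poly P (v$2) + v$1 * poly Q (v$2)"
    if "v \<in> ?V" for v
    using polynomial_fun_linear_in_x[OF p] unfolding V by blast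
  obtain N' P' Q' where q': "(v$2 - 2) ^ N' * q v = poly P' (v$2) + v$1 * poly Q' (v$2)"
    if "v \<in> ?V" for v
    using polynomial_fun_linear_in_x[OF q] unfolding V by blast
  \<comment> \<open>\<open>n\<close> is z - 2 times the norm of P + x Q under the conjugation that
    sends x to -x; likewise \<open>n'\<close>.\<close>
  define n n' where n: "n = [:-2, 1:] * P\<^sup>2 - [:-1, -1, 1:] * Q\<^sup>2"
    and n': "n' = [:-2, 1:] * P'\<^sup>2 - [:-1, -1, 1:] * Q'\<^sup>2"
  \<comment> \<open>The factor \<open>[:-2, 1:]\<close> settles z = 2, over which the curve has no
    point.\<close>
  have "poly ([:-2, 1:] * n * n') z = 0" for z
  proof (cases "z = 2")
    case False
    \<comment> \<open>Over any other z lie the conjugate points (x, z) and (-x, z). Up to powers of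
      z - 2, \<open>n\<close> at z is the product of the values of \<open>p\<close> at these
      points.\<close>
    define x where "x = csqrt ((z\<^sup>2 - z - 1) / (z - 2))"
    have x: "(z - 2) * x\<^sup>2 = z\<^sup>2 - z - 1" using False by (simp add: x_def power2_csqrt)
    define v w where v: "v = (vector [x, z] :: complex^2)" and w: "w = (vector [-x, z] :: complex^2)"
    have vw: "v \<in> ?V" "w \<in> ?V" unfolding V by (simp_all add: v w x)
    have "poly n z = (z - 2) * (poly P z)\<^sup>2 - (z\<^sup>2 - z - 1) * (poly Q z)\<^sup>2"
      by (simp add: n algebra_simps power2_eq_square)
    also have "\<dots> = (z - 2) * (poly P z + x * poly Q z) * (poly P z - x * poly Q z)"
      unfolding x[symmetric] by (simp add: algebra_simps power2_eq_square)
    also have "\<dots> = (z - 2) * ((z - 2) ^ N * p v) * ((z - 2) ^ N * p w)"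
      using p'[OF vw(1)] p'[OF vw(2)] by (simp add: v w)
    finally have 1: "poly n z = (z - 2) * ((z - 2) ^ N * p v) * ((z - 2) ^ N * p w)" .
    have "poly n' z = (z - 2) * (poly P' z)\<^sup>2 - (z\<^sup>2 - z - 1) * (poly Q' z)\<^sup>2"
      by (simp add: n' algebra_simps power2_eq_square)
    also have "\<dots> = (z - 2) * (poly P' z + x * poly Q' z) * (poly P' z - x * poly Q' z)"
      unfolding x[symmetric] by (simp add: algebra_simps power2_eq_square)
    also have "\<dots> = (z - 2) * ((z - 2) ^ N' * q v) * ((z - 2) ^ N' * q w)"
      using q'[OF vw(1)] q'[OF vw(2)] by (simp add: v w)
    finally have 2: "poly n' z = (z - 2) * ((z - 2) ^ N' * q v) * ((z - 2) ^ N' * q w)" .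
    show ?thesis using pq[OF vw(1)] unfolding poly_mult 1 2 by auto
  qed simp
  then have "[:-2, 1:] * n * n' = 0" using poly_all_0_iff_0 by blast
  then have "n = 0 \<or> n' = 0" by (simp del: mult_pCons_left)
  then have "P = 0 \<and> Q = 0 \<or> P' = 0 \<and> Q' = 0"
    using norm_form_eq_0 unfolding n n' by blast
  \<comment> \<open>At z = 2 the equation would read 0 = 1. Hence the powers of z - 2 in
    \<open>p'\<close> and \<open>q'\<close> can be cancelled.\<close>
  moreover have "v$2 - 2 \<noteq> 0" if "v \<in> ?V" for v :: "complex^2"
    using that unfolding V by auto
  ultimately show "(\<forall>v\<in>?V. p v = 0) \<or> (\<forall>v\<in>?V. q v = 0)"
    using p' q' by fastforce
qed

section \<open>The diagonal embedding of the plane curve into space\<close>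

lemma diagonal_image:
  "(\<lambda>v :: complex^2. vector [v$1, v$1, v$2] :: complex^3) ` {v. P (v$1) (v$2)} =
    {v. v$1 = v$2 \<and> P (v$1) (v$3)}"
proof (intro equalityI subsetI)
  fix v :: "complex^3" assume "v \<in> {v. v$1 = v$2 \<and> P (v$1) (v$3)}"
  then show "v \<in> (\<lambda>v :: complex^2. vector [v$1, v$1, v$2] :: complex^3) ` {v. P (v$1) (v$2)}"
    by (intro image_eqI[of _ _ "vector [v$1, v$3]"]) (auto simp: vec_eq_iff forall_3)
qed auto

lemma algebraic_set_diagonal:
  assumes "polynomial_fun p"
  shows "algebraic_set {v :: complex^3. v$1 = v$2 \<and> p v = 0}"
proof -
  have "algebraic_set ({v :: complex^3. v$1 - v$2 = 0} \<inter> {v. p v = 0})"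
    by (intro algebraic_set_Int algebraic_set_zeros polynomial_fun_intros assms)
  then show ?thesis by (simp add: Collect_conj_eq[symmetric])
qed

lemma polynomial_map_diagonal:
  "polynomial_map (\<lambda>v :: complex^2. vector [v$1, v$1, v$2] :: complex^3)"
  unfolding polynomial_map_def forall_3 by (auto intro: polynomial_fun_intros)

theorem proposition5p1:
  fixes K M :: "(real^4) set" and p :: "real^4"
    and \<alpha> \<beta> :: "(real \<Rightarrow> real^4) set"
    and X :: "(complex^3) set" and C :: "(complex^2) set"
  assumes "figure_eight_knot K"
    and "M = sphere 0 1 - K"
    and "p \<in> M"
    and "group_presentation (fundamental_group M p)
           (case_two_generators \<alpha> \<beta>) {figure_eight_relator}"
    and "X = character_variety (fundamental_group M p) \<alpha> \<beta>"
    and "C = {v. ((v$1)^2 - v$2 - 2) * ((v$2)^2 - (1 + (v$1)^2) * v$2 + 2 * (v$1)^2 - 1) = 0}"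
  shows "X = {v. v$1 = v$2 \<and>
               ((v$1)^2 - v$3 - 2) * ((v$3)^2 - (1 + (v$1)^2) * v$3 + 2 * (v$1)^2 - 1) = 0}
    \<and> algebraic_set_isomorphism X C (\<lambda>v. vector [v$1, v$3])
    \<and> card (irreducible_components X) = 2
    \<and> card (irreducible_components C) = 2"
proof -
  let ?g = "\<lambda>v :: complex^2. vector [v$1, v$1, v$2] :: complex^3"
  let ?C1 = "{v :: complex^2. (v$1)\<^sup>2 - v$2 - 2 = 0}"
  let ?C2 = "{v :: complex^2. (v$2)\<^sup>2 - (1 + (v$1)\<^sup>2) * v$2 + 2 * (v$1)\<^sup>2 - 1 = 0}"
  have X: "X = {v. v$1 = v$2 \<and>
               ((v$1)^2 - v$3 - 2) * ((v$3)^2 - (1 + (v$1)^2) * v$3 + 2 * (v$1)^2 - 1) = 0}"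
    unfolding assms(5) by (rule character_variety_figure_eight) fact
  have gC: "?g ` C = X"
    unfolding X assms(6) by (rule diagonal_image)
  have C12: "C = ?C1 \<union> ?C2" using assms(6) by auto
  \<comment> \<open>The embedding carries the decomposition of \<open>C\<close> to \<open>X\<close>,
    so that irreducibility needs to be proved only in the plane.\<close>
  have X12: "X = ?g ` ?C1 \<union> ?g ` ?C2"
    unfolding gC[symmetric] C12 by (rule image_Un)
  have g1: "?g ` ?C1 = {v. v$1 = v$2 \<and> (v$1)\<^sup>2 - v$3 - 2 = 0}"
    by (rule diagonal_image)
  have g2: "?g ` ?C2 = {v. v$1 = v$2 \<and> (v$3)\<^sup>2 - (1 + (v$1)\<^sup>2) * v$3 + 2 * (v$1)\<^sup>2 - 1 = 0}"
    by (rule diagonal_image)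
  have "algebraic_set X" "algebraic_set C" "algebraic_set (?g ` ?C1)" "algebraic_set (?g ` ?C2)"
    unfolding X assms(6) g1 g2
    by (intro algebraic_set_diagonal algebraic_set_zeros polynomial_fun_intros)+
  note alg = this
  have "algebraic_set_isomorphism X C (\<lambda>v. vector [v$1, v$3])"
    unfolding algebraic_set_isomorphism_def
  proof (intro conjI exI[of _ ?g] alg polynomial_map_diagonal)
    show "polynomial_map (\<lambda>v :: complex^3. vector [v$1, v$3] :: complex^2)"
      unfolding polynomial_map_def forall_2 by (auto intro: polynomial_fun_intros)
    show "?g ` C \<subseteq> X" using gC by simp
  qed (auto simp: X assms(6) vec_eq_iff forall_2 forall_3)
  moreover have "card (irreducible_components C) = 2"
    unfolding C12
  proof (rule card_irreducible_components_Un)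
    have "vector [0, -2] \<in> ?C1 - ?C2" "vector [1, 1] \<in> ?C2 - ?C1" by simp_all
    then show "\<not> ?C1 \<subseteq> ?C2" "\<not> ?C2 \<subseteq> ?C1" by blast+
  qed (fact irreducible_reducible_characters irreducible_irreducible_characters)+
  moreover have "card (irreducible_components X) = 2"
    unfolding X12
  proof (rule card_irreducible_components_Un)
    show "irreducible_algebraic_set (?g ` ?C1)"
      by (intro irreducible_algebraic_set_image irreducible_reducible_characters
          polynomial_map_diagonal alg)
    show "irreducible_algebraic_set (?g ` ?C2)"
      by (intro irreducible_algebraic_set_image irreducible_irreducible_characters
          polynomial_map_diagonal alg)
    have "vector [0, 0, -2] \<in> ?g ` ?C1 - ?g ` ?C2" "vector [1, 1, 1] \<in> ?g ` ?C2 - ?g ` ?C1"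
      unfolding g1 g2 by simp_all
    then show "\<not> ?g ` ?C1 \<subseteq> ?g ` ?C2" "\<not> ?g ` ?C2 \<subseteq> ?g ` ?C1" by blast+
  qed
  ultimately show ?thesis using X by blast
qed

end
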